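(* Let $(X,d)$ be a metric space and let $f : (0,\infty) \to X$ be a continuous function. If the limit $\lim_{n\to\infty} f(nx)$ exists in $X$ for all $x > 0$, then the limit $\lim_{x\to\infty} f(x)$ also exists in $X$.
   Context: Here $n$ ranges over $\mathbb{N}=\{1,2,\ldots\}$. The metric space $X$ is not assumed to be complete or separable. *)

theory Defs
  imports "HOL-Analysis.Analysis"
begin

end

theory Submission
  imports Defs
begin

text \<open>
  Two facts are combined. The limits of \<open>f (n x)\<close> along rational \<open>x\<close> all agree,
  because two such sequences share a subsequence; call the common value \<open>L\<close>. And by Baire's theorem the
  sequences \<open>f (n x)\<close> are, for a given precision \<open>\<epsilon>\<close>, uniformly Cauchy up to \<open>\<epsilon>\<close> from some
  index \<open>N\<close> on, for all \<open>x\<close> in some interval \<open>(a, b)\<close>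
  (\<open>uniformly_Cauchy_up_to_on_interval\<close>). Hence \<open>f (n x)\<close> is within \<open>\<epsilon>\<close> of \<open>L\<close> for every
  rational \<open>x\<close> in \<open>(a, b)\<close> and every \<open>n \<ge> N\<close>, and by continuity of \<open>f\<close> for every real \<open>x\<close>
  in \<open>(a, b)\<close>. Finally the dilates \<open>n (a, b)\<close> with \<open>n \<ge> N\<close> overlap
  eventually and cover a neighbourhood of infinity (\<open>eventually_in_dilate\<close>), so \<open>f\<close> is
  eventually within \<open>\<epsilon>\<close> of \<open>L\<close>. The target space may be incomplete: no limit has to be
  constructed in it, since \<open>L\<close> is the limit of one of the given sequences.
\<close>

lemma closed_cover_interior_nonempty:
  fixes E :: "nat \<Rightarrow> 'a :: {complete_space, metric_space} set"
  assumes "\<And>N. closed (E N)" and "(\<Union>N. E N) = UNIV"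
  obtains N where "interior (E N) \<noteq> {}"
proof -
  have "\<exists>N. interior (E N) \<noteq> {}"
  proof (rule ccontr)
    assume "\<not> ?thesis"
    then have "\<And>T. T \<in> range E \<Longrightarrow> closedin euclidean T \<and> euclidean interior_of T = {}"
      using assms(1) by auto
    then have "euclidean interior_of \<Union>(range E) = {}"
      by (rule Baire_category_alt[OF disjI1[OF completely_metrizable_space_euclidean]
            countable_image[OF countableI_type]])
    then show False using assms(2) by simp
  qed
  then show ?thesis using that by blast
qed

text \<open>
  Let \<open>E N\<close> consist of the points whose sequence is Cauchy up to \<open>e\<close> from index \<open>N + 1\<close> on.
  These sets are closed by continuity of \<open>f\<close> and cover everything, so one of them contains an
  interval. The half-line is not complete in its usual metric; the substitution \<open>x = exp y\<close> moves
  the problem to the real line, where Baire's theorem applies directly. Starting at \<open>N + 1\<close> keeps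
  away from the index \<open>0\<close>, which would evaluate \<open>f\<close> at \<open>0\<close>, where it need not be continuous.
\<close>

lemma uniformly_Cauchy_up_to_on_interval:
  fixes f :: "real \<Rightarrow> 'a :: metric_space"
  assumes cont: "continuous_on {0<..} f"
    and Cau: "\<And>x. x > 0 \<Longrightarrow> Cauchy (\<lambda>n. f (real n * x))"
    and "e > 0"
  obtains a b N where "0 < a" "a < b" "0 < N"
    "\<forall>x\<in>{a<..<b}. \<forall>m\<ge>N. \<forall>n\<ge>N. dist (f (real m * x)) (f (real n * x)) \<le> e"
proof -
  define E where "E = (\<lambda>N. \<Inter>m\<in>{Suc N..}. \<Inter>n\<in>{Suc N..}.
      {y. dist (f (real m * exp y)) (f (real n * exp y)) \<le> e})"
  have cont_dil: "continuous_on UNIV (\<lambda>y. f (real n * exp y))" if "0 < n" for n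
    by (rule continuous_on_compose2[OF cont]) (use that in \<open>auto intro!: continuous_intros\<close>)
  have "closed {y. dist (f (real m * exp y)) (f (real n * exp y)) \<le> e}" if "0 < m" "0 < n" for m n
    by (rule closed_Collect_le[OF continuous_on_dist[OF cont_dil cont_dil] continuous_on_const])
       (fact that)+
  then have "closed (E N)" for N
    unfolding E_def by (intro closed_INT ballI) simp
  moreover have "(\<Union>N. E N) = UNIV"
  proof -
    have "\<exists>N. y \<in> E N" for y
    proof -
      obtain M where "\<And>m n. \<lbrakk>M \<le> m; M \<le> n\<rbrakk> \<Longrightarrow>
          dist (f (real m * exp y)) (f (real n * exp y)) < e"
        using metric_CauchyD[OF Cau[OF exp_gt_zero] \<open>e > 0\<close>, of y] by auto
      then have "y \<in> E M"
        unfolding E_def by (simp add: less_imp_le)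
      then show ?thesis ..
    qed
    then show ?thesis by auto
  qed
  ultimately obtain N where "interior (E N) \<noteq> {}"
    by (rule closed_cover_interior_nonempty)
  then obtain y r where "0 < r" and ball: "ball y r \<subseteq> E N"
    by (auto simp: mem_interior)
  show ?thesis
  proof (rule that[of "exp y" "exp (y + r)" "Suc N"])
    have "x \<in> exp ` E N" if x: "exp y < x" "x < exp (y + r)" for x
    proof -
      have "0 < x" using x(1) by (meson exp_gt_zero less_trans)
      then have "y < ln x" "ln x < y + r"
        using x ln_less_cancel_iff[of "exp y" x] ln_less_cancel_iff[of x "exp (y + r)"] by auto
      then have "ln x \<in> E N"
        by (intro subsetD[OF ball]) (simp add: dist_real_def)
      then show ?thesis using \<open>0 < x\<close> by (intro image_eqI[of _ _ "ln x"]) auto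
    qed
    then show "\<forall>x\<in>{exp y<..<exp (y + r)}. \<forall>m\<ge>Suc N. \<forall>n\<ge>Suc N.
        dist (f (real m * x)) (f (real n * x)) \<le> e"
      unfolding E_def by fastforce
  qed (use \<open>0 < r\<close> in auto)
qed

text \<open>
  The sequences for \<open>x = p / q\<close> and for \<open>1\<close> share the subsequence \<open>f (p k)\<close>.
\<close>

lemma limit_along_rational_multiples:
  fixes f :: "real \<Rightarrow> 'a :: t2_space"
  assumes ex: "\<And>x. x > 0 \<Longrightarrow> \<exists>L. (\<lambda>n. f (real n * x)) \<longlonglongrightarrow> L"
    and L: "(\<lambda>n. f (real n)) \<longlonglongrightarrow> L"
    and x: "x \<in> \<rat>" "x > 0"
  shows "(\<lambda>n. f (real n * x)) \<longlonglongrightarrow> L"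
proof -
  obtain p q :: nat where pq: "q \<noteq> 0" "\<bar>x\<bar> = real p / real q"
    using x(1) by (rule Rats_abs_nat_div_natE)
  have xpq: "x = real p / real q" using pq(2) x(2) by simp
  have "p > 0" using xpq x(2) by (cases p) auto
  obtain K where K: "(\<lambda>n. f (real n * x)) \<longlonglongrightarrow> K" using ex[OF x(2)] by blast
  have "strict_mono (\<lambda>k. q * k)" "strict_mono (\<lambda>k. p * k)"
    using pq(1) \<open>p > 0\<close> by (auto simp: strict_mono_def)
  from LIMSEQ_subseq_LIMSEQ[OF K this(1)] LIMSEQ_subseq_LIMSEQ[OF L this(2)]
  have "(\<lambda>k. f (real p * real k)) \<longlonglongrightarrow> K" "(\<lambda>k. f (real p * real k)) \<longlonglongrightarrow> L"
    using pq(1) by (auto simp: o_def xpq field_simps)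
  then have "K = L" by (rule LIMSEQ_unique)
  with K show ?thesis by simp
qed

lemma dist_le_on_interval_from_rationals:
  fixes g :: "real \<Rightarrow> 'a :: metric_space"
  assumes cont: "continuous_on {a<..<b} g"
    and le: "\<And>x. \<lbrakk>x \<in> \<rat>; a < x; x < b\<rbrakk> \<Longrightarrow> dist (g x) L \<le> e"
    and x: "a < x" "x < b"
  shows "dist (g x) L \<le> e"
proof (rule ccontr)
  assume "\<not> ?thesis"
  then have "e < dist (g x) L" by simp
  moreover have "(g \<longlongrightarrow> g x) (at_right x)"
    using cont x by (simp add: continuous_on_eq_continuous_at isCont_def filterlim_at_split)
  then have "((\<lambda>y. dist (g y) L) \<longlongrightarrow> dist (g x) L) (at_right x)"
    by (intro tendsto_dist tendsto_const)
  ultimately have "eventually (\<lambda>y. e < dist (g y) L) (at_right x)"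
    by (rule order_tendstoD(1)[rotated])
  then obtain c where "x < c" and c: "\<And>y. \<lbrakk>x < y; y < c\<rbrakk> \<Longrightarrow> e < dist (g y) L"
    by (auto simp: eventually_at_right[OF x(2)])
  obtain y where "y \<in> \<rat>" "x < y" "y < min b c"
    using Rats_dense_in_real[of x "min b c"] x(2) \<open>x < c\<close> by auto
  then show False using le[of y] c[of y] x(1) by auto
qed

text \<open>
  Consecutive dilates \<open>n (a, b)\<close> and \<open>(n + 1) (a, b)\<close> overlap as soon as \<open>n (b - a) > a\<close>.
\<close>

lemma eventually_in_dilate:
  fixes a b :: real
  assumes "0 < a" "a < b"
  shows "eventually (\<lambda>t. \<exists>n\<ge>N. \<exists>x. a < x \<and> x < b \<and> t = real n * x) at_top"
proof -
  have "eventually (\<lambda>t. t > 0 \<and> t > real N * b \<and> t * (b - a) > a * b) at_top"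
  proof (intro eventually_conj)
    show "eventually (\<lambda>t. t * (b - a) > a * b) at_top"
      using eventually_gt_at_top[of "a * b / (b - a)"]
      by eventually_elim (use assms in \<open>simp add: field_simps\<close>)
  qed (rule eventually_gt_at_top)+
  then show ?thesis
  proof eventually_elim
    case (elim t)
    \<comment> \<open>The least multiplier \<open>n\<close> with \<open>t / n < b\<close>.\<close>
    define n where "n = Suc (nat \<lfloor>t / b\<rfloor>)"
    have "0 \<le> t / b" using elim assms by simp
    then have n: "t / b < real n" "real n \<le> t / b + 1"
      unfolding n_def by linarith+
    have "0 < real n" by (simp add: n_def)
    have "real N < t / b" using elim assms by (simp add: field_simps)
    then have "N \<le> n" using n(1) by linarith
    moreover have "t / real n < b"
      using n(1) \<open>0 < real n\<close> assms by (simp add: field_simps)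
    moreover have "a < t / real n"
    proof -
      have "a * real n \<le> a * (t / b + 1)" using n(2) assms by simp
      also have "\<dots> < t" using elim assms by (simp add: field_simps)
      finally show ?thesis using \<open>0 < real n\<close> by (simp add: field_simps)
    qed
    ultimately show ?case
      using \<open>0 < real n\<close> by (intro exI[of _ n] conjI exI[of _ "t / real n"]) auto
  qed
qed

theorem mainTheorem4:
  fixes f :: "real \<Rightarrow> 'a :: metric_space"
  assumes "continuous_on {0<..} f"
    and "\<And>x::real. x > 0 \<Longrightarrow> \<exists>L. (\<lambda>n::nat. f (real n * x)) \<longlonglongrightarrow> L"
  shows "\<exists>L. (f \<longlongrightarrow> L) at_top"
proof -
  obtain L where L: "(\<lambda>n. f (real n)) \<longlonglongrightarrow> L"
    using assms(2)[of 1] by auto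
  have rat: "(\<lambda>n. f (real n * x)) \<longlonglongrightarrow> L" if "x \<in> \<rat>" "x > 0" for x
    by (rule limit_along_rational_multiples[OF _ L that]) (rule assms(2))
  have Cau: "Cauchy (\<lambda>n. f (real n * x))" if "x > 0" for x
    using assms(2)[OF that] LIMSEQ_imp_Cauchy by blast
  have "eventually (\<lambda>t. dist (f t) L < e) at_top" if "e > 0" for e
  proof -
    have "e / 2 > 0" using that by simp
    obtain a b N where ab: "0 < a" "a < b" "0 < N" and
      unif: "\<forall>x\<in>{a<..<b}. \<forall>m\<ge>N. \<forall>n\<ge>N. dist (f (real m * x)) (f (real n * x)) \<le> e / 2"
      by (rule uniformly_Cauchy_up_to_on_interval[OF assms(1) Cau \<open>e / 2 > 0\<close>])
    have near: "dist (f (real n * x)) L \<le> e / 2" if "N \<le> n" "a < x" "x < b" for n x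
    proof (rule dist_le_on_interval_from_rationals[where g = "\<lambda>x. f (real n * x)"])
      have "0 < n" using ab(3) that(1) by simp
      then show "continuous_on {a<..<b} (\<lambda>x. f (real n * x))"
        using ab(1)
        by (intro continuous_on_compose2[OF assms(1)] continuous_intros) auto
      show "dist (f (real n * y)) L \<le> e / 2" if y: "y \<in> \<rat>" "a < y" "y < b" for y
      proof (rule LIMSEQ_le_const2)
        show "(\<lambda>m. dist (f (real n * y)) (f (real m * y))) \<longlonglongrightarrow> dist (f (real n * y)) L"
          using y ab(1) by (intro tendsto_dist tendsto_const rat) auto
        show "\<exists>M. \<forall>m\<ge>M. dist (f (real n * y)) (f (real m * y)) \<le> e / 2"
          using unif \<open>N \<le> n\<close> y(2,3) by (intro exI[of _ N]) simp
      qed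
    qed (use that in auto)
    show ?thesis
      using eventually_in_dilate[OF ab(1,2), of N]
    proof eventually_elim
      case (elim t)
      then have "dist (f t) L \<le> e / 2" using near by auto
      then show ?case using \<open>e > 0\<close> by simp
    qed
  qed
  then have "(f \<longlongrightarrow> L) at_top" by (rule tendstoI)
  then show ?thesis ..
qed

end
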